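(* Let $X=W_1\oplus\cdots\oplus W_k$ be an orthogonal partition of $X$ (a direct sum decomposition into mutually orthogonal subspaces), and let $L\subset X$ be a line (a 1-dimensional subspace over the scalar field of $X$). Then $$\sum_{i=1}^k \cos^2\Theta_{L,W_i} = 1.$$
   Context: $X$ is an $n$-dimensional vector space over $\mathbb{R}$ (real case) or $\mathbb{C}$ (complex case) with inner product $\langle\cdot,\cdot\rangle$ (Hermitian in the complex case, conjugate-linear in the first argument). Blades: a $p$-blade is a simple multivector $\nu=v_1\wedge\cdots\wedge v_p\in\Lambda^pX$; if $\nu\neq0$ it represents the $p$-dimensional subspace $V=\mathrm{span}(v_1,\ldots,v_p)$. Nonzero scalars in $\Lambda^0X$ are $0$-blades representing $\{0\}$. $\Lambda X$ has the inner product given on $p$-blades by $\langle v_1\wedge\cdots\wedge v_p,\,w_1\wedge\cdots\wedge w_p\rangle=\det(\langle v_i,w_j\rangle)$, extended (sesqui)linearly, with distinct grades orthogonal; $\|\nu\|=\sqrt{\langle\nu,\nu\rangle}$. Grassmann angle: for subspaces $V,W\subset X$, let $P$ be the orthogonal projection of $X$ onto $W$, acting on blades by $P(v_1\wedge\cdots\wedge v_p)=Pv_1\wedge\cdots\wedge Pv_p$ (identity on scalars). The Grassmann angle $\Theta_{V,W}\in[0,\frac\pi2]$ is defined by $\cos\Theta_{V,W}=\|P\nu\|/\|\nu\|$ for any nonzero blade $\nu$ representing $V$ (independent of $\nu$). *)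

theory Defs
  imports "HOL-Analysis.Analysis" "HOL-Library.Poly_Mapping" "Jordan_Normal_Form.Determinant"
begin

no_notation Matrix.vec_index (infixl "$" 100)

text \<open>The scalar fields. By the Gelfand-Mazur theorem a \<open>real_normed_field\<close> is isomorphic to the
  reals or to the complex numbers, and the axiom then forces \<open>conjugate\<close> to be the
  identity resp. complex conjugation. On \<open>complex\<close>, the order is the one of
  \<open>Complex_Order\<close>, in which \<open>0 \<le> z\<close> means that \<open>z\<close> is real and nonnegative.\<close>

class real_or_complex = real_normed_field + conjugatable_ordered_field +
  assumes mult_conjugate: "x * conjugate x = (norm x)\<^sup>2 *\<^sub>R 1"

instance real :: real_or_complex
  by standard (simp add: power2_eq_square)

instance complex :: real_or_complex
  by standard (simp add: scaleR_conv_of_real complex_norm_square del: of_real_power)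


section \<open>Inner product spaces over the reals or the complex numbers\<close>

locale inner_space = vector_space scale
  for scale :: "'k::real_or_complex \<Rightarrow> 'a::ab_group_add \<Rightarrow> 'a" +
  fixes ip :: "'a \<Rightarrow> 'a \<Rightarrow> 'k"
  assumes ip_add_right: "ip x (y + z) = ip x y + ip x z"
    and ip_scale_right: "ip x (scale c y) = c * ip x y"
    and ip_commute: "ip y x = conjugate (ip x y)"
    and ip_pos: "x \<noteq> 0 \<Longrightarrow> 0 < ip x x"

lemma inner_space_real: "inner_space scaleR (inner :: 'a::real_inner \<Rightarrow> 'a \<Rightarrow> real)"
  by unfold_locales (auto simp: inner_add_right inner_commute algebra_simps)

lemma inner_space_complex:
  "inner_space (*s) (\<lambda>x y :: complex ^ 'n. \<Sum>i\<in>UNIV. cnj (x $ i) * y $ i)"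
proof
  fix x :: "complex ^ 'n" assume "x \<noteq> 0"
  then obtain j where "x $ j \<noteq> 0" by (auto simp: Finite_Cartesian_Product.vec_eq_iff)
  then have "0 < (\<Sum>i\<in>UNIV. (cmod (x $ i))\<^sup>2)"
    by (intro sum_pos2[of _ j]) auto
  moreover have "(\<Sum>i\<in>UNIV. cnj (x $ i) * x $ i) = of_real (\<Sum>i\<in>UNIV. (cmod (x $ i))\<^sup>2)"
    by (simp add: complex_norm_square mult.commute del: of_real_power)
  ultimately show "0 < (\<Sum>i\<in>UNIV. cnj (x $ i) * x $ i)"
    by (simp add: less_complex_def)
qed (auto simp: algebra_simps sum.distrib sum_distrib_left)


section \<open>The exterior algebra\<close>

text \<open>The tensor algebra of \<open>X\<close> modulo the ideal generated by all \<open>v \<otimes> v\<close>, in the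
  following presentation: finitely supported functions on words over \<open>X\<close> form the free vector space
  on all words, and the multilinearity and alternation relations below, inserted between arbitrary
  words \<open>us\<close> and \<open>ws\<close>, span the subspace that is factored out. Words of length \<open>p\<close> yield the
  summand of grade \<open>p\<close>; the empty word is the unit of the scalars. Multivectors are cosets.\<close>

type_synonym ('a, 'k) multivector = "('a list \<Rightarrow>\<^sub>0 'k) set"

definition fscale :: "'k \<Rightarrow> ('b \<Rightarrow>\<^sub>0 'k) \<Rightarrow> ('b \<Rightarrow>\<^sub>0 'k::field)" where
  "fscale c x = Poly_Mapping.map ((*) c) x"

lemma lookup_fscale [simp]: "Poly_Mapping.lookup (fscale c x) u = c * Poly_Mapping.lookup x u"
  unfolding fscale_def by transfer (auto simp: when_def)

global_interpretation free: vector_space "fscale :: 'k::field \<Rightarrow> ('b \<Rightarrow>\<^sub>0 'k) \<Rightarrow> _"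
  by unfold_locales (auto intro!: poly_mapping_eqI simp: lookup_add algebra_simps)

definition free_map :: "('a \<Rightarrow> 'b) \<Rightarrow> ('a list \<Rightarrow>\<^sub>0 'k) \<Rightarrow> ('b list \<Rightarrow>\<^sub>0 'k::field)" where
  "free_map f x = (\<Sum>u\<in>Poly_Mapping.keys x. Poly_Mapping.single (map f u) (Poly_Mapping.lookup x u))"

context inner_space
begin

inductive_set relators :: "('a list \<Rightarrow>\<^sub>0 'k) set" where
  rel_add: "Poly_Mapping.single (us @ (a + b) # ws) 1 - Poly_Mapping.single (us @ a # ws) 1
      - Poly_Mapping.single (us @ b # ws) 1 \<in> relators"
| rel_scale: "Poly_Mapping.single (us @ scale c a # ws) 1
      - Poly_Mapping.single (us @ a # ws) c \<in> relators"
| rel_alt: "Poly_Mapping.single (us @ a # a # ws) 1 \<in> relators"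

definition mv_class :: "('a list \<Rightarrow>\<^sub>0 'k) \<Rightarrow> ('a, 'k) multivector" where
  "mv_class x = {y. y - x \<in> free.span relators}"

definition wedge :: "'a list \<Rightarrow> ('a, 'k) multivector" where
  "wedge vs = mv_class (Poly_Mapping.single vs 1)"

definition mv_scalar :: "'k \<Rightarrow> ('a, 'k) multivector" where
  "mv_scalar c = mv_class (Poly_Mapping.single [] c)"

definition mv_zero :: "('a, 'k) multivector" where
  "mv_zero = mv_class 0"

definition gram :: "'a list \<Rightarrow> 'a list \<Rightarrow> 'k" where
  "gram vs ws = (if length vs = length ws
     then Determinant.det (Matrix.mat (length vs) (length vs) (\<lambda>(i, j). ip (vs ! i) (ws ! j))) else 0)"

definition free_inner :: "('a list \<Rightarrow>\<^sub>0 'k) \<Rightarrow> ('a list \<Rightarrow>\<^sub>0 'k) \<Rightarrow> 'k" where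
  "free_inner x y = (\<Sum>u\<in>Poly_Mapping.keys x. \<Sum>w\<in>Poly_Mapping.keys y. conjugate (Poly_Mapping.lookup x u) * Poly_Mapping.lookup y w * gram u w)"

text \<open>The next two definitions do not depend on the representatives (the second one for linear
  \<open>f\<close>), so \<open>the_elem\<close> is applied to singletons; see \<open>mv_inner_class\<close> and \<open>ext_map_class\<close> below.\<close>

definition mv_inner :: "('a, 'k) multivector \<Rightarrow> ('a, 'k) multivector \<Rightarrow> 'k" where
  "mv_inner A B = the_elem {free_inner x y | x y. x \<in> A \<and> y \<in> B}"

definition ext_map :: "('a \<Rightarrow> 'a) \<Rightarrow> ('a, 'k) multivector \<Rightarrow> ('a, 'k) multivector" where
  "ext_map f A = the_elem ((\<lambda>x. mv_class (free_map f x)) ` A)"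

text \<open>\<open>mv_inner A A\<close> is real and nonnegative; \<open>norm\<close> only turns it into an element of \<open>real\<close>.\<close>

definition mv_norm :: "('a, 'k) multivector \<Rightarrow> real" where
  "mv_norm A = sqrt (norm (mv_inner A A))"

text \<open>\<open>represents \<nu> V\<close>: \<open>\<nu>\<close> is a nonzero blade and \<open>V\<close> is the subspace it represents.\<close>

inductive represents :: "('a, 'k) multivector \<Rightarrow> 'a set \<Rightarrow> bool" where
  rep_scalar: "c \<noteq> 0 \<Longrightarrow> represents (mv_scalar c) {0}"
| rep_wedge: "vs \<noteq> [] \<Longrightarrow> wedge vs \<noteq> mv_zero \<Longrightarrow> represents (wedge vs) (span (set vs))"


subsection \<open>Well-definedness of the inner product and of the induced maps\<close>

lemma conjugate_sign: "conjugate (signof p :: 'k) = signof p"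
proof -
  have "conjugate (1::'k) = 1" using mult_conjugate[of "1::'k"] by simp
  then show ?thesis by (simp add: sign_def conjugate_neg)
qed

lemma conjugate_prod: "conjugate (\<Prod>i\<in>A. f i :: 'k) = (\<Prod>i\<in>A. conjugate (f i))"
proof -
  have "conjugate (1::'k) = 1" using mult_conjugate[of "1::'k"] by simp
  then show ?thesis by (induction A rule: infinite_finite_induct) (auto simp: conjugate_dist_mul)
qed

lemma gram_commute: "gram ws vs = conjugate (gram vs ws)"
proof (cases "length vs = length ws")
  case True
  define n where "n = length vs"
  let ?A = "Matrix.mat n n (\<lambda>(i, j). ip (vs ! i) (ws ! j))"
  let ?B = "Matrix.mat n n (\<lambda>(i, j). ip (ws ! i) (vs ! j))"
  have "Determinant.det ?B = (\<Sum>p | p permutes {0..<n}. signof p * (\<Prod>j<n. ?B $$ (p j, j)))"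
    by (rule det_col) simp
  also have "\<dots> = (\<Sum>p | p permutes {0..<n}. conjugate (signof p * (\<Prod>j = 0..<n. ?A $$ (j, p j))))"
  proof (intro sum.cong refl)
    fix p assume "p \<in> {p. p permutes {0..<n}}"
    then have p: "p j < n" if "j < n" for j
      using that permutes_in_image[of p "{0..<n}" j] by auto
    have "(\<Prod>j<n. ?B $$ (p j, j)) = (\<Prod>j<n. conjugate (?A $$ (j, p j)))"
      by (intro prod.cong) (auto simp: p ip_commute[symmetric])
    then show "signof p * (\<Prod>j<n. ?B $$ (p j, j)) = conjugate (signof p * (\<Prod>j = 0..<n. ?A $$ (j, p j)))"
      by (simp add: conjugate_dist_mul conjugate_sign conjugate_prod atLeast0LessThan)
  qed
  also have "\<dots> = conjugate (Determinant.det ?A)"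
    by (subst det_def'[of _ n]) (auto simp: sum_conjugate finite_permutations)
  finally show ?thesis using True by (simp add: gram_def n_def)
qed (simp add: gram_def)

lemma gram_col:
  assumes "length vs = Suc (length us + length ws)"
  shows "\<exists>g. \<forall>a. gram vs (us @ a # ws) =
    (\<Sum>p | p permutes {0..<length vs}. g p * ip (vs ! p (length us)) a)"
proof (intro exI allI)
  let ?n = "length vs" and ?k = "length us"
  fix a
  let ?A = "\<lambda>a. Matrix.mat ?n ?n (\<lambda>(i, j). ip (vs ! i) ((us @ a # ws) ! j))"
  have "gram vs (us @ a # ws) = (\<Sum>p | p permutes {0..<?n}. signof p * (\<Prod>j<?n. ?A a $$ (p j, j)))"
    using assms by (simp add: gram_def det_col[of _ ?n])
  also have "\<dots> = (\<Sum>p | p permutes {0..<?n}.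
      (signof p * (\<Prod>j\<in>{..<?n} - {?k}. ?A 0 $$ (p j, j))) * ip (vs ! p ?k) a)"
  proof (intro sum.cong refl)
    fix p assume "p \<in> {p. p permutes {0..<?n}}"
    then have p: "p j < ?n" if "j < ?n" for j
      using that permutes_in_image[of p "{0..<?n}" j] by auto
    have k: "?k \<in> {..<?n}" using assms by simp
    have "(\<Prod>j<?n. ?A a $$ (p j, j)) = ?A a $$ (p ?k, ?k) * (\<Prod>j\<in>{..<?n} - {?k}. ?A a $$ (p j, j))"
      by (rule prod.remove) (use k in auto)
    also have "(\<Prod>j\<in>{..<?n} - {?k}. ?A a $$ (p j, j)) = (\<Prod>j\<in>{..<?n} - {?k}. ?A 0 $$ (p j, j))"
      by (intro prod.cong) (auto simp: p nth_append nth_Cons split: nat.split)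
    also have "?A a $$ (p ?k, ?k) = ip (vs ! p ?k) a"
      using k p by simp
    finally show "signof p * (\<Prod>j<?n. ?A a $$ (p j, j)) =
      (signof p * (\<Prod>j\<in>{..<?n} - {?k}. ?A 0 $$ (p j, j))) * ip (vs ! p ?k) a"
      by (simp add: mult_ac)
  qed
  finally show "gram vs (us @ a # ws) = (\<Sum>p | p permutes {0..<?n}.
      (signof p * (\<Prod>j\<in>{..<?n} - {?k}. ?A 0 $$ (p j, j))) * ip (vs ! p ?k) a)" .
qed

lemma gram_add: "gram vs (us @ (a + b) # ws) = gram vs (us @ a # ws) + gram vs (us @ b # ws)"
proof (cases "length vs = Suc (length us + length ws)")
  case True
  from gram_col[OF True] obtain g where "\<forall>a. gram vs (us @ a # ws) =
    (\<Sum>p | p permutes {0..<length vs}. g p * ip (vs ! p (length us)) a)" by (rule exE)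
  then show ?thesis by (simp add: ip_add_right algebra_simps sum.distrib)
qed (simp add: gram_def)

lemma gram_scale: "gram vs (us @ scale c a # ws) = c * gram vs (us @ a # ws)"
proof (cases "length vs = Suc (length us + length ws)")
  case True
  from gram_col[OF True] obtain g where "\<forall>a. gram vs (us @ a # ws) =
    (\<Sum>p | p permutes {0..<length vs}. g p * ip (vs ! p (length us)) a)" by (rule exE)
  then show ?thesis by (simp add: ip_scale_right sum_distrib_left mult_ac)
qed (simp add: gram_def)

lemma gram_alt: "gram vs (us @ a # a # ws) = 0"
proof (cases "length vs = length (us @ a # a # ws)")
  case True
  let ?n = "length vs"
  let ?A = "Matrix.mat ?n ?n (\<lambda>(i, j). ip (vs ! i) ((us @ a # a # ws) ! j))"
  have "Determinant.det ?A = 0"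
    by (rule det_identical_columns[of _ ?n "length us" "Suc (length us)"])
      (use True in \<open>auto simp: nth_append\<close>)
  then show ?thesis using True by (simp add: gram_def)
qed (simp add: gram_def)

lemma free_inner_superset:
  assumes "finite S" "Poly_Mapping.keys x \<subseteq> S" "finite T" "Poly_Mapping.keys y \<subseteq> T"
  shows "free_inner x y = (\<Sum>u\<in>S. \<Sum>w\<in>T.
    conjugate (Poly_Mapping.lookup x u) * Poly_Mapping.lookup y w * gram u w)"
proof -
  have "(\<Sum>w\<in>Poly_Mapping.keys y. conjugate (Poly_Mapping.lookup x u) * Poly_Mapping.lookup y w * gram u w) =
     (\<Sum>w\<in>T. conjugate (Poly_Mapping.lookup x u) * Poly_Mapping.lookup y w * gram u w)" for u
    by (rule sum.mono_neutral_left) (use assms in \<open>auto simp: in_keys_iff\<close>)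
  moreover have "(\<Sum>u\<in>Poly_Mapping.keys x. \<Sum>w\<in>T.
    conjugate (Poly_Mapping.lookup x u) * Poly_Mapping.lookup y w * gram u w) = (\<Sum>u\<in>S. \<Sum>w\<in>T.
    conjugate (Poly_Mapping.lookup x u) * Poly_Mapping.lookup y w * gram u w)"
    by (rule sum.mono_neutral_left) (use assms in \<open>auto simp: in_keys_iff\<close>)
  ultimately show ?thesis by (simp add: free_inner_def)
qed

lemma free_inner_add_right: "free_inner x (y + z) = free_inner x y + free_inner x z"
proof -
  let ?S = "Poly_Mapping.keys x" and ?T = "Poly_Mapping.keys y \<union> Poly_Mapping.keys z"
  have *: "Poly_Mapping.keys (y + z) \<subseteq> ?T" by (rule keys_add)
  show ?thesis
    using * by (simp add: free_inner_superset[of ?S x ?T] lookup_add algebra_simps sum.distrib)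
qed

lemma free_inner_scale_right: "free_inner x (fscale c y) = c * free_inner x y"
proof -
  have *: "Poly_Mapping.keys (fscale c y) \<subseteq> Poly_Mapping.keys y" by (auto simp: in_keys_iff)
  show ?thesis
    using * by (simp add: free_inner_superset[of "Poly_Mapping.keys x" x "Poly_Mapping.keys y"] 
      sum_distrib_left mult_ac)
qed

lemma free_inner_commute: "free_inner y x = conjugate (free_inner x y)"
proof -
  have "free_inner y x = (\<Sum>w\<in>Poly_Mapping.keys x. \<Sum>u\<in>Poly_Mapping.keys y. 
    conjugate (Poly_Mapping.lookup y u) * Poly_Mapping.lookup x w * gram u w)"
    unfolding free_inner_def by (rule sum.swap)
  also have "\<dots> = conjugate (free_inner x y)"
    unfolding free_inner_def
    by (simp add: sum_conjugate conjugate_dist_mul gram_commute[symmetric] mult_ac)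
  finally show ?thesis .
qed

lemma free_inner_single: "free_inner (Poly_Mapping.single u c) (Poly_Mapping.single w d) = conjugate c * d * gram u w"
  by (simp add: free_inner_superset[of "{u}" _ "{w}"])

lemma free_inner_relators:
  assumes "r \<in> free.span relators" shows "free_inner x r = 0"
proof -
  have single: "free_inner x (Poly_Mapping.single w d) = 
    (\<Sum>u\<in>Poly_Mapping.keys x. conjugate (Poly_Mapping.lookup x u) * d * gram u w)" for w d
    by (simp add: free_inner_superset[of "Poly_Mapping.keys x" _ "{w}"])
  have diff: "free_inner x (y - z) = free_inner x y - free_inner x z" for y z
    using free_inner_add_right[of x "y - z" z] by simp
  from assms show ?thesis
  proof (induction rule: free.span_induct_alt)
    case base
    show ?case by (simp add: free_inner_def)
  next
    case (step c r y)
    from step(1) have "free_inner x r = 0"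
    proof cases
      case (rel_add us a b ws)
      show ?thesis
        unfolding rel_add diff single gram_add by (simp add: distrib_left sum.distrib)
    next
      case (rel_scale us c a ws)
      show ?thesis
        unfolding rel_scale diff single gram_scale by (simp add: mult.assoc)
    next
      case (rel_alt us a ws)
      show ?thesis
        unfolding rel_alt single gram_alt by simp
    qed
    with step show ?case by (simp add: free_inner_add_right free_inner_scale_right)
  qed
qed

lemma mv_class_refl: "x \<in> mv_class x"
  by (simp add: mv_class_def free.span_zero)

lemma mv_class_eqI:
  assumes "x - y \<in> free.span relators" shows "mv_class x = mv_class y"
proof -
  have "z - x \<in> free.span relators \<longleftrightarrow> z - y \<in> free.span relators" for z
  proof
    assume "z - x \<in> free.span relators"
    then have "(z - x) + (x - y) \<in> free.span relators" using assms by (rule free.span_add)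
    then show "z - y \<in> free.span relators" by simp
  next
    assume "z - y \<in> free.span relators"
    then have "(z - y) - (x - y) \<in> free.span relators" using assms by (rule free.span_diff)
    then show "z - x \<in> free.span relators" by simp
  qed
  then show ?thesis unfolding mv_class_def by blast
qed

lemma mv_inner_class: "mv_inner (mv_class x) (mv_class y) = free_inner x y"
proof -
  have 1: "free_inner z y' = free_inner z y" if "y' \<in> mv_class y" for y y' z
    using free_inner_relators[of "y' - y" z] free_inner_add_right[of z "y' - y" y] that
    by (simp add: mv_class_def)
  have "free_inner x' y' = free_inner x y" if "x' \<in> mv_class x" "y' \<in> mv_class y" for x' y'
    using 1[OF that(1)] 1[OF that(2)] free_inner_commute by metis
  then have "{free_inner x' y' |x' y'. x' \<in> mv_class x \<and> y' \<in> mv_class y} = {free_inner x y}"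
    using mv_class_refl by blast
  then show ?thesis by (simp add: mv_inner_def)
qed

lemma mv_inner_wedge: "mv_inner (wedge vs) (wedge ws) = gram vs ws"
proof -
  have "conjugate (1::'k) = 1" using mult_conjugate[of "1::'k"] by simp
  then show ?thesis by (simp add: wedge_def mv_inner_class free_inner_single)
qed

lemma free_map_superset:
  assumes "finite S" "Poly_Mapping.keys x \<subseteq> S"
  shows "free_map f x = (\<Sum>u\<in>S. Poly_Mapping.single (map f u) (Poly_Mapping.lookup x u))"
  unfolding free_map_def
  by (rule sum.mono_neutral_left) (use assms in \<open>auto simp: in_keys_iff\<close>)

lemma free_map_add: "free_map f (x + y) = free_map f x + free_map f y"
proof -
  let ?T = "Poly_Mapping.keys x \<union> Poly_Mapping.keys y"
  have *: "Poly_Mapping.keys (x + y) \<subseteq> ?T" by (rule keys_add)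
  show ?thesis
    using * by (simp add: free_map_superset[of ?T] lookup_add single_add sum.distrib)
qed

lemma fscale_single: "fscale c (Poly_Mapping.single u d) = Poly_Mapping.single u (c * d)"
  by (rule poly_mapping_eqI) (simp add: lookup_single when_def)

lemma free_map_scale: "free_map f (fscale c x) = fscale c (free_map f x)"
proof -
  have *: "Poly_Mapping.keys (fscale c x) \<subseteq> Poly_Mapping.keys x" by (auto simp: in_keys_iff)
  show ?thesis
    using * by (simp add: free_map_superset[of "Poly_Mapping.keys x"] free.scale_sum_right fscale_single)
qed

lemma free_map_single: "free_map f (Poly_Mapping.single u c) = Poly_Mapping.single (map f u) c"
  by (simp add: free_map_superset[of "{u}"])

lemma free_map_relators:
  assumes "\<And>a b. f (a + b) = f a + f b" "\<And>c a. f (scale c a) = scale c (f a)"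
    and "r \<in> free.span relators"
  shows "free_map f r \<in> free.span relators"
  using assms(3)
proof (induction rule: free.span_induct_alt)
  case base
  show ?case by (simp add: free_map_def free.span_zero)
next
  case (step c r y)
  have diff: "free_map f (y - z) = free_map f y - free_map f z" for y z :: "'a list \<Rightarrow>\<^sub>0 'k"
    using free_map_add[of f "y - z" z] by simp
  from step(1) have "free_map f r \<in> relators"
  proof cases
    case (rel_add us a b ws)
    show ?thesis unfolding rel_add diff free_map_single map_append list.map assms
      by (rule relators.rel_add)
  next
    case (rel_scale us c a ws)
    show ?thesis unfolding rel_scale diff free_map_single map_append list.map assms
      by (rule relators.rel_scale)
  next
    case (rel_alt us a ws)
    show ?thesis unfolding rel_alt free_map_single map_append list.map
      by (rule relators.rel_alt)
  qed
  with step show ?case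
    by (simp add: free_map_add free_map_scale free.span_add free.span_scale free.span_base)
qed

lemma ext_map_class:
  assumes "\<And>a b. f (a + b) = f a + f b" "\<And>c a. f (scale c a) = scale c (f a)"
  shows "ext_map f (mv_class x) = mv_class (free_map f x)"
proof -
  have "mv_class (free_map f y) = mv_class (free_map f x)" if "y \<in> mv_class x" for y
  proof (rule mv_class_eqI)
    have "free_map f y - free_map f x = free_map f (y - x)"
      using free_map_add[of f "y - x" x] by simp
    then show "free_map f y - free_map f x \<in> free.span relators"
      using free_map_relators[OF assms, of "y - x"] that by (simp add: mv_class_def)
  qed
  then have "(\<lambda>y. mv_class (free_map f y)) ` mv_class x = {mv_class (free_map f x)}"
    using mv_class_refl by blast
  then show ?thesis by (simp add: ext_map_def)
qed

lemma ext_map_wedge: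
  assumes "\<And>a b. f (a + b) = f a + f b" "\<And>c a. f (scale c a) = scale c (f a)"
  shows "ext_map f (wedge vs) = wedge (map f vs)"
  by (simp add: wedge_def ext_map_class[OF assms] free_map_single)


section \<open>The Grassmann angle\<close>

definition orth_proj :: "'a set \<Rightarrow> 'a \<Rightarrow> 'a" where
  "orth_proj W x = (THE y. y \<in> W \<and> (\<forall>w\<in>W. ip w (x - y) = 0))"

definition grassmann_angle :: "'a set \<Rightarrow> 'a set \<Rightarrow> real" where
  "grassmann_angle V W = (THE \<theta>. 0 \<le> \<theta> \<and> \<theta> \<le> pi / 2 \<and>
     (\<forall>\<nu>. represents \<nu> V \<longrightarrow> cos \<theta> = mv_norm (ext_map (orth_proj W) \<nu>) / mv_norm \<nu>))"

definition orthogonal_partition :: "nat \<Rightarrow> (nat \<Rightarrow> 'a set) \<Rightarrow> bool" where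
  "orthogonal_partition k W \<longleftrightarrow>
     (\<forall>i\<in>{1..k}. subspace (W i)) \<and>
     (\<forall>x. \<exists>!w. w \<in> (\<Pi>\<^sub>E i\<in>{1..k}. W i) \<and> x = (\<Sum>i=1..k. w i)) \<and>
     (\<forall>i\<in>{1..k}. \<forall>j\<in>{1..k}. i \<noteq> j \<longrightarrow> (\<forall>u\<in>W i. \<forall>v\<in>W j. ip u v = 0))"

end

end

(* A blade representing a line is a single nonzero vector, since any two vectors of a line are
   dependent. So cos^2 of the angle between the line through v and W_i is |P_i v|^2 / |v|^2, where
   P_i v is the component of v in W_i, and Pythagoras' theorem gives the sum. *)
theory Submission
  imports Defs
begin

context inner_space
begin

section \<open>Sesquilinearity, norms and Pythagoras' theorem\<close>

lemma ip_zero_right [simp]: "ip x 0 = 0"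
  using ip_add_right[of x 0 0] by simp

lemma ip_zero_left [simp]: "ip 0 x = 0"
  by (metis ip_commute ip_zero_right conjugate_zero)

lemma ip_add_left: "ip (x + y) z = ip x z + ip y z"
  by (metis ip_commute ip_add_right conjugate_dist_add)

lemma ip_scale_left: "ip (scale c x) y = conjugate c * ip x y"
  by (metis ip_commute ip_scale_right conjugate_dist_mul)

lemma ip_diff_right: "ip x (y - z) = ip x y - ip x z"
  using ip_add_right[of x "y - z" z] by simp

lemma ip_sum_right: "ip x (\<Sum>i\<in>A. f i) = (\<Sum>i\<in>A. ip x (f i))"
  by (induction A rule: infinite_finite_induct) (auto simp: ip_add_right)

lemma ip_sum_left: "ip (\<Sum>i\<in>A. f i) x = (\<Sum>i\<in>A. ip (f i) x)"
  by (induction A rule: infinite_finite_induct) (auto simp: ip_add_left)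

lemma ip_self_eq_0_iff: "ip x x = 0 \<longleftrightarrow> x = 0"
  using ip_pos[of x] by (auto simp: less_le)

text \<open>As \<open>ip x x\<close> is self-conjugate, its square is the square of its norm. The order excludes the
  negative root, because \<open>norm (ip x x)\<close> has the form \<open>t * conjugate t\<close>.\<close>

lemma ip_self_norm: "ip x x = norm (ip x x) *\<^sub>R 1"
proof (cases "x = 0")
  case False
  define z where "z = ip x x"
  define t :: 'k where "t = sqrt (norm z) *\<^sub>R 1"
  have "t * conjugate t = norm z *\<^sub>R 1"
    unfolding mult_conjugate by (simp add: t_def)
  then have pos: "0 \<le> norm z *\<^sub>R (1::'k)"
    using conjugate_square_positive[of t] by simp
  have "conjugate z = z" unfolding z_def by (simp add: ip_commute[symmetric])
  then have "z * z = (norm z *\<^sub>R 1) * (norm z *\<^sub>R 1)"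
    using mult_conjugate[of z] by (simp add: power2_eq_square)
  then have "z = norm z *\<^sub>R 1 \<or> z = - (norm z *\<^sub>R 1)"
    by (simp only: square_eq_iff)
  moreover have "z \<noteq> - (norm z *\<^sub>R 1)"
  proof
    assume "z = - (norm z *\<^sub>R 1)"
    then have "z + norm z *\<^sub>R 1 = 0" by (metis ab_left_minus)
    moreover have "0 < z + norm z *\<^sub>R 1"
      using add_pos_nonneg[OF _ pos] ip_pos[OF False] z_def by blast
    ultimately show False by simp
  qed
  ultimately show ?thesis by (simp add: z_def)
qed simp

text \<open>Take norms in \<open>mult_conjugate\<close> and cancel \<open>norm c\<close>.\<close>

lemma norm_conjugate: "norm (conjugate c :: 'k) = norm c"
proof (cases "c = 0")
  case False
  have "norm c * norm (conjugate c) = norm c * norm c"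
    using mult_conjugate[of c] by (metis norm_mult norm_scaleR norm_one
        abs_power2 mult.right_neutral power2_eq_square)
  then show ?thesis using False by simp
qed simp

lemma norm_ip_scale: "norm (ip (scale c x) (scale c x)) = (norm c)\<^sup>2 * norm (ip x x)"
  by (simp add: ip_scale_left ip_scale_right norm_mult norm_conjugate power2_eq_square)

lemma pythagoras:
  assumes "\<And>i j. i \<in> A \<Longrightarrow> j \<in> A \<Longrightarrow> i \<noteq> j \<Longrightarrow> ip (w i) (w j) = 0"
  shows "norm (ip (\<Sum>i\<in>A. w i) (\<Sum>i\<in>A. w i)) = (\<Sum>i\<in>A. norm (ip (w i) (w i)))"
proof (cases "finite A")
  case True
  have "ip (\<Sum>i\<in>A. w i) (\<Sum>i\<in>A. w i) = (\<Sum>i\<in>A. \<Sum>j\<in>A. ip (w i) (w j))"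
    unfolding ip_sum_left unfolding ip_sum_right ..
  also have "\<dots> = (\<Sum>i\<in>A. \<Sum>j\<in>A. if j = i then ip (w i) (w i) else 0)"
    using assms by (intro sum.cong) auto
  also have "\<dots> = (\<Sum>i\<in>A. ip (w i) (w i))"
    using True by simp
  \<comment> \<open>Each diagonal term is its own norm, so the norm of the sum equals the sum of the
    norms and is not merely bounded by it.\<close>
  also have "\<dots> = (\<Sum>i\<in>A. norm (ip (w i) (w i)) *\<^sub>R 1)"
    by (intro sum.cong refl ip_self_norm)
  also have "\<dots> = (\<Sum>i\<in>A. norm (ip (w i) (w i))) *\<^sub>R 1"
    by (simp add: scaleR_left.sum)
  finally show ?thesis by (simp add: sum_nonneg)
qed simp

section \<open>Uniqueness of the orthogonal projection\<close>

lemma orth_proj_eqI: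
  assumes W: "subspace W" and y: "y \<in> W" "\<And>w. w \<in> W \<Longrightarrow> ip w (x - y) = 0"
  shows "orth_proj W x = y"
  unfolding orth_proj_def
proof (rule the_equality)
  fix z assume z: "z \<in> W \<and> (\<forall>w\<in>W. ip w (x - z) = 0)"
  have "z - y \<in> W" using W z y by (simp add: subspace_diff)
  \<comment> \<open>The second argument is \<open>z - y\<close> itself, so this vector is orthogonal
    to itself and vanishes.\<close>
  then have "ip (z - y) ((x - y) - (x - z)) = 0"
    using z y(2) by (simp add: ip_diff_right)
  then show "z = y" by (simp add: ip_self_eq_0_iff)
qed (use y in auto)

section \<open>Blades representing a line\<close>

lemma mv_norm_wedge_single: "mv_norm (wedge [a]) = sqrt (norm (ip a a))"
  by (simp add: mv_norm_def mv_inner_wedge gram_def det_single)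

text \<open>Multivectors are cosets, so nonvanishing is detected by an invariant of the coset, here
  the norm.\<close>

lemma wedge_single_nonzero:
  assumes "a \<noteq> 0" shows "wedge [a] \<noteq> mv_zero"
proof
  assume "wedge [a] = mv_zero"
  then have "mv_norm (wedge [a]) = 0"
    by (simp add: mv_norm_def mv_zero_def mv_inner_class free_inner_def)
  then show False using assms by (simp add: mv_norm_wedge_single ip_self_eq_0_iff)
qed

lemma wedge_parallel: "wedge (scale c v # scale d v # ws) = mv_zero"
proof -
  define S where "S = (\<lambda>us c. Poly_Mapping.single us c :: 'a list \<Rightarrow>\<^sub>0 'k)"
  have 1: "S (scale c v # scale d v # ws) 1 - S (v # scale d v # ws) c \<in> relators"
    using rel_scale[of "[]" c v "scale d v # ws"] by (simp add: S_def)
  have 2: "S (v # scale d v # ws) 1 - S (v # v # ws) d \<in> relators"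
    using rel_scale[of "[v]" d v ws] by (simp add: S_def)
  have 3: "S (v # v # ws) 1 \<in> relators"
    using rel_alt[of "[]" v ws] by (simp add: S_def)
  have scale_S: "fscale c (S us d) = S us (c * d)" for c us d
    by (simp add: S_def fscale_single)
  \<comment> \<open>Telescoping: pull \<open>c\<close> out of the first slot, then \<open>d\<close>
    out of the second; what remains is a multiple of an alternation relator.\<close>
  have "S (scale c v # scale d v # ws) 1 =
      (S (scale c v # scale d v # ws) 1 - S (v # scale d v # ws) c)
      + fscale c (S (v # scale d v # ws) 1 - S (v # v # ws) d) + fscale (c * d) (S (v # v # ws) 1)"
    by (simp add: free.scale_right_diff_distrib scale_S)
  also have "\<dots> \<in> free.span relators"
    using 1 2 3 by (intro free.span_add free.span_scale free.span_base)
  finally show ?thesis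
    by (simp add: wedge_def mv_zero_def S_def mv_class_eqI)
qed

text \<open>Scalars represent only the zero space, and a longer word over the line starts with two
  multiples of \<open>v\<close>, so its wedge vanishes. Listing all representing blades lets the
  quantifier in \<open>grassmann_angle\<close> be evaluated.\<close>

lemma represents_line_iff:
  assumes v: "v \<noteq> 0"
  shows "represents \<nu> (span {v}) \<longleftrightarrow> (\<exists>c. c \<noteq> 0 \<and> \<nu> = wedge [scale c v])"
proof
  assume "represents \<nu> (span {v})"
  then show "\<exists>c. c \<noteq> 0 \<and> \<nu> = wedge [scale c v]"
  proof cases
    case rep_scalar
    then show ?thesis using v span_base[of v "{v}"] by auto
  next
    case (rep_wedge vs)
    have mult: "\<exists>c. a = scale c v" if "a \<in> set vs" for a
      using that rep_wedge(2) span_base[of a "set vs"] by (auto simp: span_singleton)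
    obtain a ws where vs: "vs = a # ws" using rep_wedge(3) by (cases vs) auto
    obtain c where a: "a = scale c v" using mult[of a] vs by auto
    show ?thesis
    proof (cases ws)
      case Nil
      \<comment> \<open>Otherwise the word would span only the zero space, which does not contain
        \<open>v\<close>.\<close>
      have "c \<noteq> 0"
        using rep_wedge(2) vs a Nil v span_base[of v "{v}"] by (auto simp: span_singleton)
      then show ?thesis using rep_wedge(1) vs a Nil by auto
    next
      case (Cons b xs)
      obtain d where "b = scale d v" using mult[of b] vs Cons by auto
      then have "wedge vs = mv_zero" by (simp add: vs a Cons wedge_parallel)
      then show ?thesis using rep_wedge(4) by contradiction
    qed
  qed
next
  assume "\<exists>c. c \<noteq> 0 \<and> \<nu> = wedge [scale c v]"
  then obtain c where c: "c \<noteq> 0" "\<nu> = wedge [scale c v]" by blast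
  have "span {scale c v} = span {v}"
    using span_image_scale[of "{v}" "\<lambda>_. c"] c(1) by simp
  moreover have "represents (wedge [scale c v]) (span (set [scale c v]))"
    using c v by (intro represents.rep_wedge wedge_single_nonzero) auto
  ultimately show "represents \<nu> (span {v})" using c by simp
qed

section \<open>The Grassmann angle of a line\<close>

lemma cos_grassmann_angle_line:
  assumes v: "v \<noteq> 0"
    and W: "subspace W"
    and P: "\<And>x. P x \<in> W" "\<And>x w. w \<in> W \<Longrightarrow> ip w (x - P x) = 0"
    and le: "norm (ip (P v) (P v)) \<le> norm (ip v v)"
  shows "cos (grassmann_angle (span {v}) W) = sqrt (norm (ip (P v) (P v)) / norm (ip v v))"
proof -
  define r where "r = sqrt (norm (ip (P v) (P v)) / norm (ip v v))"
  have oP: "orth_proj W x = P x" for x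
    using P by (intro orth_proj_eqI W)
  \<comment> \<open>Linearity makes \<open>ext_map\<close> well defined on cosets. It follows from
    uniqueness: the sum, and below the multiple, of projections has the defining property of a
    projection.\<close>
  have add: "orth_proj W (x + y) = orth_proj W x + orth_proj W y" for x y
    unfolding oP[of x] oP[of y]
  proof (rule orth_proj_eqI[OF W])
    fix w assume "w \<in> W"
    then have "ip w (x - P x) + ip w (y - P y) = 0" by (simp add: P)
    moreover have "x + y - (P x + P y) = (x - P x) + (y - P y)" by simp
    ultimately show "ip w (x + y - (P x + P y)) = 0" by (simp only: ip_add_right)
  qed (simp add: W P subspace_add)
  have scl: "orth_proj W (scale c x) = scale c (orth_proj W x)" for c x
    unfolding oP[of x]
  proof (rule orth_proj_eqI[OF W])
    fix w assume "w \<in> W"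
    then have "c * ip w (x - P x) = 0" by (simp add: P)
    then show "ip w (scale c x - scale c (P x)) = 0"
      by (simp add: ip_diff_right ip_scale_right algebra_simps)
  qed (simp add: W P subspace_scale)
  \<comment> \<open>Both norms pick up the factor \<open>norm c\<close>, which cancels; hence the
    ratio is the same for all representing blades.\<close>
  have ratio: "mv_norm (ext_map (orth_proj W) (wedge [scale c v])) / mv_norm (wedge [scale c v]) = r"
    if "c \<noteq> 0" for c
    using that scl[of c v]
    by (simp add: ext_map_wedge[OF add scl] oP mv_norm_wedge_single norm_ip_scale r_def
        real_sqrt_mult real_sqrt_divide)
  have r: "0 \<le> r" "r \<le> 1"
    using le v by (auto simp: r_def ip_self_eq_0_iff divide_le_eq_1)
  have cos_iff: "(\<forall>\<nu>. represents \<nu> (span {v}) \<longrightarrow>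
      cos \<theta> = mv_norm (ext_map (orth_proj W) \<nu>) / mv_norm \<nu>) \<longleftrightarrow> cos \<theta> = r" for \<theta>
    \<comment> \<open>The blade with \<open>c = 1\<close> shows that the quantifier is not
      vacuous.\<close>
    unfolding represents_line_iff[OF v] using ratio one_neq_zero by metis
  \<comment> \<open>As \<open>r\<close> lies between 0 and 1, \<open>arccos r\<close> lies in the
    prescribed range, on which the cosine is injective.\<close>
  have "grassmann_angle (span {v}) W = arccos r"
    unfolding grassmann_angle_def cos_iff
  proof (rule the_equality)
    show "0 \<le> arccos r \<and> arccos r \<le> pi / 2 \<and> cos (arccos r) = r"
      using r arccos_le_pi2[of r] by (simp add: arccos_lbound)
  next
    fix \<theta> assume "0 \<le> \<theta> \<and> \<theta> \<le> pi / 2 \<and> cos \<theta> = r"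
    then show "\<theta> = arccos r" using arccos_cos[of \<theta>] by simp
  qed
  moreover have "cos (arccos r) = r" using r by simp
  ultimately show ?thesis unfolding r_def by (rule ssubst)
qed

section \<open>Orthogonal partitions and the sum of squared cosines\<close>

lemma orthogonal_partition_components:
  assumes "orthogonal_partition k W"
  obtains w where "\<And>i x. i \<in> {1..k} \<Longrightarrow> w i x \<in> W i"
    and "\<And>x. (\<Sum>i=1..k. w i x) = x"
    and "\<And>i u x. i \<in> {1..k} \<Longrightarrow> u \<in> W i \<Longrightarrow> ip u (x - w i x) = 0"
proof -
  have "\<forall>x. \<exists>w. w \<in> (\<Pi>\<^sub>E i\<in>{1..k}. W i) \<and> x = (\<Sum>i=1..k. w i)"
    using assms unfolding orthogonal_partition_def by blast
  then obtain f where f: "\<And>x. f x \<in> (\<Pi>\<^sub>E i\<in>{1..k}. W i)" "\<And>x. x = (\<Sum>i=1..k. f x i)"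
    by metis
  \<comment> \<open>The \<open>i\<close>-th component is the orthogonal projection onto
    \<open>W i\<close>: pairing the decomposition of \<open>x\<close> with \<open>u\<close> leaves
    only the \<open>i\<close>-th term.\<close>
  have orth: "ip u (x - f x i) = 0" if i: "i \<in> {1..k}" and u: "u \<in> W i" for i u x
  proof -
    have "ip u x = ip u (\<Sum>j=1..k. f x j)" using f(2)[of x] by simp
    also have "\<dots> = (\<Sum>j\<in>{1..k}. if j = i then ip u (f x i) else 0)"
      unfolding ip_sum_right
    proof (intro sum.cong refl)
      fix j assume j: "j \<in> {1..k}"
      then have "f x j \<in> W j" using f(1)[of x] by (auto simp: PiE_iff)
      then show "ip u (f x j) = (if j = i then ip u (f x i) else 0)"
        using assms i j u unfolding orthogonal_partition_def by metis
    qed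
    also have "\<dots> = ip u (f x i)" using i by simp
    finally show ?thesis by (simp add: ip_diff_right)
  qed
  show ?thesis
  proof (rule that[of "\<lambda>i x. f x i"])
    show "f x i \<in> W i" if "i \<in> {1..k}" for i x using f(1)[of x] that by (auto simp: PiE_iff)
    show "(\<Sum>i=1..k. f x i) = x" for x using f(2)[of x] by simp
  qed (rule orth)
qed

lemma sum_cos_grassmann_angle_line:
  assumes part: "orthogonal_partition k W" and v: "v \<noteq> 0"
  shows "(\<Sum>i=1..k. (cos (grassmann_angle (span {v}) (W i)))\<^sup>2) = 1"
proof -
  obtain w where w: "\<And>i x. i \<in> {1..k} \<Longrightarrow> w i x \<in> W i" "\<And>x. (\<Sum>i=1..k. w i x) = x"
    "\<And>i u x. i \<in> {1..k} \<Longrightarrow> u \<in> W i \<Longrightarrow> ip u (x - w i x) = 0"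
    using orthogonal_partition_components[OF part] by blast
  have "ip (w i v) (w j v) = 0" if "i \<in> {1..k}" "j \<in> {1..k}" "i \<noteq> j" for i j
    using part that w(1) unfolding orthogonal_partition_def by blast
  from pythagoras[of "{1..k}" "\<lambda>i. w i v", OF this]
  have sum: "norm (ip v v) = (\<Sum>i=1..k. norm (ip (w i v) (w i v)))"
    unfolding w(2) .
  have "(cos (grassmann_angle (span {v}) (W i)))\<^sup>2 = norm (ip (w i v) (w i v)) / norm (ip v v)"
    if i: "i \<in> {1..k}" for i
  proof -
    \<comment> \<open>By \<open>sum\<close> the left side is one term of a nonnegative sum equal to
      the right side. This bound keeps the cosine at most 1.\<close>
    have "norm (ip (w i v) (w i v)) \<le> norm (ip v v)"
      unfolding sum by (rule member_le_sum[OF i]) auto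
    moreover have "subspace (W i)"
      using part i unfolding orthogonal_partition_def by blast
    ultimately have "cos (grassmann_angle (span {v}) (W i)) =
        sqrt (norm (ip (w i v) (w i v)) / norm (ip v v))"
      using w i by (intro cos_grassmann_angle_line v) auto
    then show ?thesis by simp
  qed
  then have "(\<Sum>i=1..k. (cos (grassmann_angle (span {v}) (W i)))\<^sup>2) =
      (\<Sum>i=1..k. norm (ip (w i v) (w i v)) / norm (ip v v))"
    by (intro sum.cong refl)
  also have "\<dots> = 1"
    unfolding sum_divide_distrib[symmetric] sum[symmetric] using v by (simp add: ip_self_eq_0_iff)
  finally show ?thesis .
qed

lemma line_eq_span:
  assumes "subspace L" "dim L = 1"
  obtains v where "v \<noteq> 0" "L = span {v}"
proof -
  obtain B where B: "B \<subseteq> L" "independent B" "L \<subseteq> span B" "card B = dim L"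
    using basis_exists by blast
  then obtain v where v: "B = {v}" using assms card_1_singletonE by metis
  \<comment> \<open>A basis is independent and so cannot contain 0.\<close>
  have "v \<noteq> 0" using B v dependent_zero by blast
  moreover have "L = span {v}" using B v assms span_minimal by blast
  ultimately show ?thesis by (rule that)
qed

end

theorem theorem4p1:
  fixes scale :: "'k::real_or_complex \<Rightarrow> 'a::ab_group_add \<Rightarrow> 'a"
    and B :: "'a set"
    and ip :: "'a \<Rightarrow> 'a \<Rightarrow> 'k"
    and k :: nat
    and W :: "nat \<Rightarrow> 'a set"
    and L :: "'a set"
  assumes "finite_dimensional_vector_space scale B"
    and "inner_space scale ip"
    and "inner_space.orthogonal_partition scale ip k W"
    and "module.subspace scale L"
    and "vector_space.dim scale L = 1"
  shows "(\<Sum>i=1..k. (cos (inner_space.grassmann_angle scale ip L (W i)))\<^sup>2) = 1"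
proof -
  interpret inner_space scale ip by fact
  obtain v where "v \<noteq> 0" "L = span {v}"
    using line_eq_span assms(4,5) by blast
  then show ?thesis using sum_cos_grassmann_angle_line assms(3) by simp
qed

end
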